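(* Let $(X,\mu,m)$ be a connected weighted graph such that every harmonic function on $X$ of finite energy is bounded. Then every harmonic map of finite energy from the graph into an Hadamard space is bounded.
   Context: Weighted graph: $X$ is a countable discrete set, $m:X\to(0,\infty)$ is extended additively to a measure on all subsets of $X$, and $\mu:X\times X\to[0,\infty)$, $(x,y)\mapsto\mu_{xy}$, is symmetric, zero on the diagonal, and satisfies $\sum_{y\in X}\mu_{xy}<\infty$ for all $x\in X$ (local finiteness is not assumed). Write $x\sim y$ if $\mu_{xy}>0$. The graph is connected if any two vertices $x,y$ are joined by a path $x=x_0\sim x_1\sim\dots\sim x_n=y$. Harmonic functions: let $F(X)=\{f:X\to\mathbb{R}\mid \sum_{y\in X}\mu_{xy}|f(y)|<\infty \text{ for all }x\in X\}$ and $\Delta f(x)=\frac1{m(x)}\sum_{y\in X}\mu_{xy}(f(x)-f(y))$ for $f\in F(X)$. A function $f:X\to\mathbb{R}$ is harmonic if $f\in F(X)$ and $\Delta f=0$. It has finite energy if $E(f)=\frac12\sum_{x,y\in X}\mu_{xy}|f(x)-f(y)|^2<\infty$. Harmonic maps: an Hadamard space $(Y,d)$ is a complete geodesic $\mathrm{CAT}(0)$ space. Let $P^1(Y)$ be the probability measures on $Y$ with finite first moment. For $\nu\in P^1(Y)$ the barycenter $b(\nu)\in Y$ is the unique minimizer of $z\mapsto\int_Y\big(d^2(z,y)-d^2(w,y)\big)\nu(dy)$, which does not depend on the choice of $w\in Y$. Put $P_x(y)=\mu_{xy}/\sum_{z\in X}\mu_{xz}$ and let $F(X,Y)$ be the set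 of maps $u:X\to Y$ with $\sum_{y\in X}d(u(y),y_0)P_x(y)<\infty$ for all $x\in X$, $y_0\in Y$. A map $u:X\to Y$ is harmonic if $u\in F(X,Y)$ and $u(x)=b(u_*P_x)$ for every $x\in X$, where $u_*P_x$ is the push forward of $P_x$ under $u$. A harmonic map $u$ has finite energy if $\frac12\sum_{x,y\in X}\mu_{xy}d^2(u(x),u(y))<\infty$. It is bounded if its image is a bounded subset of $Y$. *)

theory Defs
  imports "HOL-Analysis.Analysis" "HOL-Probability.Probability_Measure"
begin

section \<open>Weighted graphs\<close>

text \<open>The vertex set is the whole (countable) type \<open>'v\<close>; \<open>m\<close> is the vertex weight and
  \<open>\<mu> x y\<close> the edge weight. Unconditional summability \<open>summable_on\<close> expresses finiteness of a
  sum over the vertices, so vertices of infinite degree are allowed.\<close>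

locale weighted_graph =
  fixes m :: "'v::countable \<Rightarrow> real" and \<mu> :: "'v \<Rightarrow> 'v \<Rightarrow> real"
  assumes vertex_weight_pos: "0 < m x"
    and edge_weight_nonneg: "0 \<le> \<mu> x y"
    and edge_weight_sym: "\<mu> x y = \<mu> y x"
    and edge_weight_diag: "\<mu> x x = 0"
    and edge_weight_summable: "\<mu> x summable_on UNIV"

definition adjacent :: "('v \<Rightarrow> 'v \<Rightarrow> real) \<Rightarrow> 'v \<Rightarrow> 'v \<Rightarrow> bool" where
  "adjacent \<mu> x y \<longleftrightarrow> 0 < \<mu> x y"

definition connected_graph :: "('v \<Rightarrow> 'v \<Rightarrow> real) \<Rightarrow> bool" where
  "connected_graph \<mu> \<longleftrightarrow> (\<forall>x y. (adjacent \<mu>)\<^sup>*\<^sup>* x y)"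


section \<open>Energy and harmonic functions\<close>

text \<open>Energy of a map into a metric space, with values in \<open>[0, \<infinity>]\<close>. For real-valued functions
  \<open>dist (f x) (f y)\<close> is \<open>\<bar>f x - f y\<bar>\<close>.\<close>

definition energy :: "('v \<Rightarrow> 'v \<Rightarrow> real) \<Rightarrow> ('v \<Rightarrow> 'y::metric_space) \<Rightarrow> ennreal" where
  "energy \<mu> u = (\<Sum>\<^sub>\<infinity>(x, y)\<in>UNIV. ennreal (\<mu> x y * (dist (u x) (u y))\<^sup>2)) / 2"

definition finite_energy :: "('v \<Rightarrow> 'v \<Rightarrow> real) \<Rightarrow> ('v \<Rightarrow> 'y::metric_space) \<Rightarrow> bool" where
  "finite_energy \<mu> u \<longleftrightarrow> energy \<mu> u < \<infinity>"

definition laplacian_domain :: "('v \<Rightarrow> 'v \<Rightarrow> real) \<Rightarrow> ('v \<Rightarrow> real) set" where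
  "laplacian_domain \<mu> = {f. \<forall>x. (\<lambda>y. \<mu> x y * \<bar>f y\<bar>) summable_on UNIV}"

definition laplacian ::
    "('v \<Rightarrow> real) \<Rightarrow> ('v \<Rightarrow> 'v \<Rightarrow> real) \<Rightarrow> ('v \<Rightarrow> real) \<Rightarrow> 'v \<Rightarrow> real" where
  "laplacian m \<mu> f x = 1 / m x * (\<Sum>\<^sub>\<infinity>y\<in>UNIV. \<mu> x y * (f x - f y))"

definition harmonic_function ::
    "('v \<Rightarrow> real) \<Rightarrow> ('v \<Rightarrow> 'v \<Rightarrow> real) \<Rightarrow> ('v \<Rightarrow> real) \<Rightarrow> bool" where
  "harmonic_function m \<mu> f \<longleftrightarrow> f \<in> laplacian_domain \<mu> \<and> (\<forall>x. laplacian m \<mu> f x = 0)"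


section \<open>Hadamard spaces\<close>

definition geodesic_segment :: "'y::metric_space \<Rightarrow> 'y \<Rightarrow> 'y set \<Rightarrow> bool" where
  "geodesic_segment p q S \<longleftrightarrow>
     (\<exists>c. c 0 = p \<and> c (dist p q) = q \<and>
          (\<forall>s\<in>{0..dist p q}. \<forall>t\<in>{0..dist p q}. dist (c s) (c t) = \<bar>s - t\<bar>) \<and>
          S = c ` {0..dist p q})"

definition geodesic_space :: "'y::metric_space set \<Rightarrow> bool" where
  "geodesic_space Y \<longleftrightarrow> (\<forall>p\<in>Y. \<forall>q\<in>Y. \<exists>S\<subseteq>Y. geodesic_segment p q S)"

text \<open>The comparison inequality for geodesic triangles with sides \<open>S\<close>, \<open>T\<close>, \<open>U\<close> and comparison
  triangle \<open>p' q' r'\<close> in the Euclidean plane. Points on two different sides suffice: the vertices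
  can be relabelled so that these sides are \<open>S\<close> and \<open>T\<close>, and on a single side the inequality is
  an equality.\<close>

definition CAT0 :: "'y::metric_space set \<Rightarrow> bool" where
  "CAT0 Y \<longleftrightarrow>
     (\<forall>p\<in>Y. \<forall>q\<in>Y. \<forall>r\<in>Y. \<forall>S\<subseteq>Y. \<forall>T\<subseteq>Y. \<forall>U\<subseteq>Y.
        geodesic_segment p q S \<and> geodesic_segment p r T \<and> geodesic_segment q r U \<longrightarrow>
        (\<forall>p' q' r' :: real^2.
           dist p' q' = dist p q \<and> dist p' r' = dist p r \<and> dist q' r' = dist q r \<longrightarrow>
           (\<forall>x\<in>S. \<forall>y\<in>T. \<forall>x'\<in>closed_segment p' q'. \<forall>y'\<in>closed_segment p' r'.
              dist p' x' = dist p x \<and> dist p' y' = dist p y \<longrightarrow> dist x y \<le> dist x' y')))"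

definition hadamard_space :: "'y::metric_space set \<Rightarrow> bool" where
  "hadamard_space Y \<longleftrightarrow> complete Y \<and> geodesic_space Y \<and> CAT0 Y"


section \<open>Barycenters and harmonic maps\<close>

definition P1 :: "'y::metric_space measure set" where
  "P1 = {\<nu>. prob_space \<nu> \<and> sets \<nu> = sets borel \<and> (\<forall>y0. integrable \<nu> (\<lambda>y. dist y y0))}"

text \<open>\<open>z\<close> is the barycenter of \<open>\<nu>\<close>, i.e.\ the unique minimizer of the normalized second moment.
  Minimality does not depend on the base point \<open>w\<close>.\<close>

definition is_barycenter :: "'y::metric_space measure \<Rightarrow> 'y \<Rightarrow> bool" where
  "is_barycenter \<nu> z \<longleftrightarrow> \<nu> \<in> P1 \<and>
     (\<forall>w z'. z' \<noteq> z \<longrightarrow>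
        (LINT y|\<nu>. (dist z y)\<^sup>2 - (dist w y)\<^sup>2) < (LINT y|\<nu>. (dist z' y)\<^sup>2 - (dist w y)\<^sup>2))"

definition transition_prob :: "('v \<Rightarrow> 'v \<Rightarrow> real) \<Rightarrow> 'v \<Rightarrow> 'v \<Rightarrow> real" where
  "transition_prob \<mu> x y = \<mu> x y / (\<Sum>\<^sub>\<infinity>z\<in>UNIV. \<mu> x z)"

definition transition_measure :: "('v \<Rightarrow> 'v \<Rightarrow> real) \<Rightarrow> 'v \<Rightarrow> 'v measure" where
  "transition_measure \<mu> x = density (count_space UNIV) (\<lambda>y. ennreal (transition_prob \<mu> x y))"

definition harmonic_map_domain ::
    "('v \<Rightarrow> 'v \<Rightarrow> real) \<Rightarrow> ('v \<Rightarrow> 'y::metric_space) set" where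
  "harmonic_map_domain \<mu> =
     {u. \<forall>x y0. (\<lambda>y. dist (u y) y0 * transition_prob \<mu> x y) summable_on UNIV}"

definition harmonic_map :: "('v \<Rightarrow> 'v \<Rightarrow> real) \<Rightarrow> ('v \<Rightarrow> 'y::metric_space) \<Rightarrow> bool" where
  "harmonic_map \<mu> u \<longleftrightarrow> u \<in> harmonic_map_domain \<mu> \<and>
     (\<forall>x. is_barycenter (distr (transition_measure \<mu> x) borel u) (u x))"

end

theory Submission imports Defs begin

text \<open>
  Fix a point \<open>z\<close> of the Hadamard space and let \<open>f x\<close> be the distance from \<open>u x\<close> to \<open>z\<close>. The map
  \<open>u\<close> is bounded as soon as \<open>f\<close> is bounded above, and \<open>f\<close> is a nonnegative function to which linear
  potential theory applies. Its energy is at most that of \<open>u\<close>, because the distance to \<open>z\<close> is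
  1-Lipschitz, and \<open>f\<close> is subharmonic by Jensen's inequality for barycenters: the distance from
  the barycenter to \<open>z\<close> is at most the mean distance to \<open>z\<close> (\<open>barycenter_dist_le_integral\<close>).

  The analytic core is \<open>harmonic_majorant\<close>: a subharmonic function \<open>f\<close> of finite energy on a
  connected graph lies below a harmonic function \<open>h\<close> of finite energy. By assumption \<open>h\<close> is bounded,
  which bounds \<open>f\<close> from above.

  If \<open>f\<close> is itself harmonic, \<open>h = f\<close> will do; this covers every recurrent graph. Otherwise \<open>h\<close> is the
  harmonic part of \<open>f\<close> in its Royden decomposition, obtained by minimizing the energy of
  \<open>f + \<phi>\<close> over finitely supported \<open>\<phi>\<close>. Two points need care. First, energies see only differences
  of values, so the minimizing sequence could drift off to infinity. It does not: by Green's formula a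
  vertex where \<open>f\<close> is strictly subharmonic bounds the value there of any finitely supported function
  by its energy, and connectedness carries this bound to all vertices
  (\<open>energy_control_test_functions\<close>). Second, the limit of the \<open>\<phi>\<close> has to be nonnegative. Replacing
  \<open>\<phi>\<close> by its positive part does not increase the energy of \<open>f + \<phi>\<close>, because \<open>f\<close> is subharmonic
  (\<open>energy_form_pos_part_le\<close>), so the minimizing sequence may be taken nonnegative.

  Jensen's inequality is a first variation argument: moving the barycenter \<open>b\<close> a fraction \<open>t\<close> towards
  \<open>z\<close> changes the second moment, to first order in \<open>t\<close>, by at most \<open>2 t d(b, z)\<close> times the difference
  of the mean distance to \<open>z\<close> and \<open>d(b, z)\<close> (\<open>hadamard_move_towards\<close>), and minimality of \<open>b\<close>
  forces this to be nonnegative.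
\<close>

section \<open>The energy form\<close>

context weighted_graph
begin

lemma finite_energy_iff_summable:
  fixes w :: "'v \<Rightarrow> 'z::metric_space"
  shows "finite_energy \<mu> w \<longleftrightarrow> (\<lambda>(x, y). \<mu> x y * (dist (w x) (w y))\<^sup>2) summable_on UNIV"
    (is "_ \<longleftrightarrow> ?g summable_on _")
proof -
  let ?S = "\<Sum>\<^sub>\<infinity>p\<in>UNIV. ennreal (?g p)"
  have nonneg: "0 \<le> ?g p" for p
    by (auto simp: edge_weight_nonneg split: prod.split)
  have S: "?S = (SUP F\<in>{F. finite F}. ennreal (sum ?g F))"
    by (subst nonneg_infsum_complete) (auto simp: sum_ennreal nonneg)
  have "finite_energy \<mu> w \<longleftrightarrow> ?S / 2 < \<infinity>"
    by (simp add: finite_energy_def energy_def case_prod_unfold)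
  also have "\<dots> \<longleftrightarrow> ?S < \<infinity>"
    by (simp add: less_top[symmetric] ennreal_divide_eq_top_iff)
  also have "\<dots> \<longleftrightarrow> ?g summable_on UNIV"
  proof
    assume fin: "?S < \<infinity>"
    then obtain C where C: "?S = ennreal C" "0 \<le> C"
      by (cases ?S) auto
    have "sum ?g F \<le> C" if "finite F" for F
    proof -
      have "ennreal (sum ?g F) \<le> ?S"
        unfolding S using that by (auto intro: SUP_upper)
      then show ?thesis
        using C by (simp add: ennreal_le_iff)
    qed
    then show "?g summable_on UNIV"
      by (intro nonneg_bdd_above_summable_on bdd_aboveI2 nonneg) auto
  next
    assume "?g summable_on UNIV"
    then have "sum ?g F \<le> infsum ?g UNIV" if "finite F" for F
      using that by (intro finite_sum_le_infsum nonneg) auto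
    then have "?S \<le> ennreal (infsum ?g UNIV)"
      unfolding S by (intro SUP_least) (auto intro: ennreal_leI)
    then show "?S < \<infinity>"
      by (rule le_less_trans) simp
  qed
  finally show ?thesis .
qed

lemma finite_energy_real_iff:
  "finite_energy \<mu> (f :: 'v \<Rightarrow> real) \<longleftrightarrow> (\<lambda>(x, y). \<mu> x y * (f x - f y)\<^sup>2) summable_on UNIV"
  by (simp add: finite_energy_iff_summable dist_real_def)

lemma finite_energy_mono:
  fixes f :: "'v \<Rightarrow> 'a::metric_space" and g :: "'v \<Rightarrow> 'b::metric_space"
  assumes "finite_energy \<mu> g" and "\<And>x y. dist (f x) (f y) \<le> dist (g x) (g y)"
  shows "finite_energy \<mu> f"
proof -
  have "(\<lambda>p. \<mu> (fst p) (snd p) * (dist (f (fst p)) (f (snd p)))\<^sup>2) summable_on UNIV"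
  proof (rule summable_on_comparison_test)
    show "(\<lambda>p. \<mu> (fst p) (snd p) * (dist (g (fst p)) (g (snd p)))\<^sup>2) summable_on UNIV"
      using assms(1) unfolding finite_energy_iff_summable case_prod_unfold .
    fix p :: "'v \<times> 'v"
    show "\<mu> (fst p) (snd p) * (dist (f (fst p)) (f (snd p)))\<^sup>2
        \<le> \<mu> (fst p) (snd p) * (dist (g (fst p)) (g (snd p)))\<^sup>2"
      by (intro mult_left_mono power_mono assms(2) edge_weight_nonneg zero_le_dist)
    show "0 \<le> \<mu> (fst p) (snd p) * (dist (f (fst p)) (f (snd p)))\<^sup>2"
      by (intro mult_nonneg_nonneg edge_weight_nonneg zero_le_power2)
  qed
  then show ?thesis
    unfolding finite_energy_iff_summable case_prod_unfold .
qed

text \<open>The sum runs over ordered pairs, so \<open>energy_form f f\<close> is twice the energy of \<open>f\<close>.\<close>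

definition energy_form :: "('v \<Rightarrow> real) \<Rightarrow> ('v \<Rightarrow> real) \<Rightarrow> real" where
  "energy_form f g = (\<Sum>\<^sub>\<infinity>(x, y)\<in>UNIV. \<mu> x y * ((f x - f y) * (g x - g y)))"

lemma energy_form_summable:
  assumes "finite_energy \<mu> f" "finite_energy \<mu> g"
  shows "(\<lambda>(x, y). \<mu> x y * ((f x - f y) * (g x - g y))) summable_on UNIV" (is "?h summable_on _")
proof -
  let ?b = "\<lambda>p. (\<lambda>(x, y). \<mu> x y * (f x - f y)\<^sup>2) p + (\<lambda>(x, y). \<mu> x y * (g x - g y)\<^sup>2) p"
  have "?b summable_on UNIV"
    using assms unfolding finite_energy_real_iff by (rule summable_on_add)
  moreover have "norm (?h p) \<le> ?b p" for p
  proof -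
    obtain x y where p: "p = (x, y)" by (cases p)
    have "\<bar>a * b\<bar> \<le> a\<^sup>2 + b\<^sup>2" for a b :: real
      using sum_squares_bound[of a b] sum_squares_bound[of a "- b"]
      by (simp add: abs_if)
    from mult_left_mono[OF this edge_weight_nonneg[of x y]] show ?thesis
      by (simp add: p abs_mult edge_weight_nonneg distrib_left)
  qed
  ultimately have "(\<lambda>p. norm (?h p)) summable_on UNIV"
    by (rule Infinite_Sum.abs_summable_on_comparison_test')
  then show ?thesis
    by (rule abs_summable_summable)
qed

lemma has_sum_energy_form:
  assumes "finite_energy \<mu> f" "finite_energy \<mu> g"
  shows "((\<lambda>(x, y). \<mu> x y * ((f x - f y) * (g x - g y))) has_sum energy_form f g) UNIV"
  unfolding energy_form_def by (rule has_sum_infsum[OF energy_form_summable[OF assms]])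

lemma finite_energy_lincomb:
  fixes f g :: "'v \<Rightarrow> real"
  assumes "finite_energy \<mu> f" "finite_energy \<mu> g"
  shows "finite_energy \<mu> (\<lambda>x. f x + t * g x)"
proof -
  have expand: "c * ((a + t * b) - (a' + t * b'))\<^sup>2
      = c * ((a - a') * (a - a')) + 2 * t * (c * ((a - a') * (b - b')))
        + t\<^sup>2 * (c * ((b - b') * (b - b')))" for a b a' b' c :: real
    by (simp add: power2_eq_square algebra_simps)
  have "((\<lambda>p. (\<lambda>(x, y). \<mu> x y * ((f x - f y) * (f x - f y))) p
      + 2 * t * (\<lambda>(x, y). \<mu> x y * ((f x - f y) * (g x - g y))) p
      + t\<^sup>2 * (\<lambda>(x, y). \<mu> x y * ((g x - g y) * (g x - g y))) p) has_sum
      (energy_form f f + 2 * t * energy_form f g + t\<^sup>2 * energy_form g g)) UNIV"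
    by (intro has_sum_add has_sum_cmult_right has_sum_energy_form assms)
  then show ?thesis
    unfolding finite_energy_real_iff case_prod_unfold expand by (rule has_sum_imp_summable)
qed

lemma energy_form_lincomb_right:
  assumes "finite_energy \<mu> k" "finite_energy \<mu> f" "finite_energy \<mu> g"
  shows "energy_form k (\<lambda>x. f x + t * g x) = energy_form k f + t * energy_form k g"
proof -
  have expand: "c * (d * ((a + t * b) - (a' + t * b')))
      = c * (d * (a - a')) + t * (c * (d * (b - b')))" for a b a' b' c d :: real
    by (simp add: algebra_simps)
  have "((\<lambda>p. (\<lambda>(x, y). \<mu> x y * ((k x - k y) * (f x - f y))) p
      + t * (\<lambda>(x, y). \<mu> x y * ((k x - k y) * (g x - g y))) p) has_sum
      (energy_form k f + t * energy_form k g)) UNIV"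
    by (intro has_sum_add has_sum_cmult_right has_sum_energy_form assms)
  then show ?thesis
    unfolding energy_form_def[of k "\<lambda>x. f x + t * g x"] case_prod_unfold expand
    by (rule infsumI)
qed

lemma energy_form_commute: "energy_form f g = energy_form g f"
  unfolding energy_form_def by (simp add: mult.commute)

lemma energy_form_nonneg: "0 \<le> energy_form f f"
  unfolding energy_form_def by (rule infsum_nonneg) (auto simp: edge_weight_nonneg)

lemma energy_form_lincomb_square:
  assumes "finite_energy \<mu> f" "finite_energy \<mu> g"
  shows "energy_form (\<lambda>x. f x + t * g x) (\<lambda>x. f x + t * g x)
    = energy_form f f + 2 * t * energy_form f g + t\<^sup>2 * energy_form g g"
proof -
  note fin = assms finite_energy_lincomb[OF assms, of t]
  let ?h = "\<lambda>x. f x + t * g x"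
  have "energy_form ?h ?h = energy_form ?h f + t * energy_form ?h g"
    by (intro energy_form_lincomb_right fin)
  moreover have "energy_form f ?h = energy_form f f + t * energy_form f g"
    "energy_form g ?h = energy_form f g + t * energy_form g g"
    by (simp_all only: energy_form_lincomb_right fin energy_form_commute[of g f])
  ultimately show ?thesis
    unfolding energy_form_commute[of ?h f] energy_form_commute[of ?h g]
    by (simp add: power2_eq_square algebra_simps)
qed

lemma discriminant_nonpos:
  fixes a b c :: real
  assumes q: "\<And>t. 0 \<le> a + 2 * t * b + t\<^sup>2 * c" and "0 \<le> c"
  shows "b\<^sup>2 \<le> a * c"
proof (cases "c = 0")
  case True
  have "b = 0"
  proof (rule ccontr)
    assume "b \<noteq> 0"
    then have "2 * (- (a + 1) / (2 * b)) * b = - (a + 1)"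
      by simp
    then show False
      using q[of "- (a + 1) / (2 * b)"] True by simp
  qed
  with True show ?thesis by simp
next
  case False
  with \<open>0 \<le> c\<close> have "0 < c" by simp
  have "a + 2 * (- b / c) * b + (- b / c)\<^sup>2 * c = a - b\<^sup>2 / c"
    using \<open>0 < c\<close> by (simp add: power2_eq_square)
  then have "b\<^sup>2 / c \<le> a"
    using q[of "- b / c"] by simp
  then show ?thesis
    using \<open>0 < c\<close> by (simp add: pos_divide_le_eq)
qed

lemma energy_form_Cauchy_Schwarz:
  assumes "finite_energy \<mu> f" "finite_energy \<mu> g"
  shows "(energy_form f g)\<^sup>2 \<le> energy_form f f * energy_form g g"
proof -
  have q: "0 \<le> energy_form f f + 2 * t * energy_form f g + t\<^sup>2 * energy_form g g" for t
    using energy_form_nonneg[of "\<lambda>x. f x + t * g x"] energy_form_lincomb_square[OF assms, of t]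
    by simp
  show ?thesis
    by (rule discriminant_nonpos) (rule q, rule energy_form_nonneg)
qed

lemma energy_form_edge_bound:
  assumes "finite_energy \<mu> f"
  shows "\<mu> x y * (f x - f y)\<^sup>2 \<le> energy_form f f"
proof -
  let ?e = "\<lambda>(x, y). \<mu> x y * (f x - f y)\<^sup>2"
  have "sum ?e {(x, y)} \<le> infsum ?e UNIV"
    using assms unfolding finite_energy_real_iff
    by (rule finite_sum_le_infsum) (auto simp: edge_weight_nonneg)
  then show ?thesis
    by (simp add: energy_form_def power2_eq_square)
qed

text \<open>Fatou's lemma: every finite partial sum of the energy passes to the pointwise limit.\<close>

lemma energy_form_lower_semicontinuous:
  assumes fin: "\<And>n. finite_energy \<mu> (f n)" and lim: "\<And>x. (\<lambda>n. f n x) \<longlonglongrightarrow> g x"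
    and bound: "\<forall>\<^sub>F n in sequentially. energy_form (f n) (f n) \<le> C"
  shows "finite_energy \<mu> g" and "energy_form g g \<le> C"
proof -
  let ?e = "\<lambda>f :: 'v \<Rightarrow> real. \<lambda>(x, y). \<mu> x y * (f x - f y)\<^sup>2"
  have le: "sum (?e g) F \<le> C" if "finite F" for F
  proof (rule tendsto_upperbound)
    show "(\<lambda>n. sum (?e (f n)) F) \<longlonglongrightarrow> sum (?e g) F"
      unfolding case_prod_unfold by (intro tendsto_intros lim)
    show "\<forall>\<^sub>F n in sequentially. sum (?e (f n)) F \<le> C"
      using bound
    proof eventually_elim
      case (elim n)
      have "sum (?e (f n)) F \<le> infsum (?e (f n)) UNIV"
        using fin[of n] that unfolding finite_energy_real_iff
        by (intro finite_sum_le_infsum) (auto simp: edge_weight_nonneg)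
      also have "\<dots> = energy_form (f n) (f n)"
        by (simp add: energy_form_def power2_eq_square)
      finally show ?case using elim by simp
    qed
  qed auto
  have summable: "?e g summable_on UNIV"
    by (intro nonneg_bdd_above_summable_on)
      (auto intro!: bdd_aboveI2 le simp: edge_weight_nonneg)
  then show "finite_energy \<mu> g"
    by (simp add: finite_energy_real_iff)
  show "energy_form g g \<le> C"
    using infsum_le_finite_sums[OF summable le]
    by (simp add: energy_form_def power2_eq_square)
qed

text \<open>A single edge \<open>y \<sim> z\<close> contributes \<open>\<mu> y z * (f y - f z)\<^sup>2\<close> to the energy; add up along a path. The
  constant depends only on the two vertices, so small energy forces nearly constant values.\<close>

lemma energy_control_between:
  assumes "connected_graph \<mu>"
  shows "\<exists>C\<ge>0. \<forall>f. finite_energy \<mu> f \<longrightarrow> \<bar>f x - f y\<bar> \<le> C * sqrt (energy_form f f)"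
proof -
  have "(adjacent \<mu>)\<^sup>*\<^sup>* x y"
    using assms by (simp add: connected_graph_def)
  then show ?thesis
  proof induction
    case base
    then show ?case by (auto intro!: exI[of _ 0])
  next
    case (step y z)
    then obtain C where C: "C \<ge> 0"
      "\<And>f. finite_energy \<mu> f \<Longrightarrow> \<bar>f x - f y\<bar> \<le> C * sqrt (energy_form f f)"
      by blast
    have pos: "0 < \<mu> y z"
      using step.hyps by (simp add: adjacent_def)
    have "\<bar>f x - f z\<bar> \<le> (C + 1 / sqrt (\<mu> y z)) * sqrt (energy_form f f)"
      if "finite_energy \<mu> f" for f
    proof -
      have "(f y - f z)\<^sup>2 \<le> energy_form f f / \<mu> y z"
        using energy_form_edge_bound[OF that, of y z] pos by (simp add: field_simps)
      then have "\<bar>f y - f z\<bar> \<le> sqrt (energy_form f f / \<mu> y z)"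
        by (metis real_le_rsqrt power2_abs)
      then show ?thesis
        using C(2)[OF that] by (simp add: real_sqrt_divide field_simps)
    qed
    then show ?case
      using C(1) pos by (intro exI[of _ "C + 1 / sqrt (\<mu> y z)"]) auto
  qed
qed


section \<open>Green's formula\<close>

text \<open>The Laplacian without its factor \<open>1 / m x\<close>, which affects neither harmonicity nor the sign that
  defines subharmonic functions, those with \<open>net_flow f x \<le> 0\<close> for all \<open>x\<close>.\<close>

definition net_flow :: "('v \<Rightarrow> real) \<Rightarrow> 'v \<Rightarrow> real" where
  "net_flow f x = (\<Sum>\<^sub>\<infinity>y\<in>UNIV. \<mu> x y * (f x - f y))"

definition finitely_supported :: "('v \<Rightarrow> real) \<Rightarrow> bool" where
  "finitely_supported \<phi> \<longleftrightarrow> finite {x. \<phi> x \<noteq> 0}"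

lemma finitely_supported_lincomb:
  assumes "finitely_supported \<phi>" "finitely_supported \<psi>"
  shows "finitely_supported (\<lambda>x. \<phi> x + t * \<psi> x)"
  using assms unfolding finitely_supported_def
  by (auto intro: finite_subset[of _ "{x. \<phi> x \<noteq> 0} \<union> {x. \<psi> x \<noteq> 0}"])

text \<open>The edge weights at \<open>x\<close> form a finite measure, so square summable differences are summable.\<close>

lemma gradient_summable:
  assumes "finite_energy \<mu> f"
  shows "(\<lambda>y. \<mu> x y * \<bar>f x - f y\<bar>) summable_on UNIV"
proof -
  have "(\<lambda>(x, y). \<mu> x y * (f x - f y)\<^sup>2) summable_on range (Pair x)"
    using assms unfolding finite_energy_real_iff by (rule summable_on_subset_banach) simp
  then have "(\<lambda>y. \<mu> x y * (f x - f y)\<^sup>2) summable_on UNIV"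
    by (subst (asm) summable_on_reindex) (auto simp: o_def inj_on_def)
  then have "(\<lambda>y. \<mu> x y + \<mu> x y * (f x - f y)\<^sup>2) summable_on UNIV"
    by (intro summable_on_add edge_weight_summable)
  then show ?thesis
  proof (rule summable_on_comparison_test)
    fix y
    have "t \<le> 1 + t\<^sup>2" for t :: real
      using zero_le_power2[of "t - 1 / 2"] by (simp add: power2_eq_square algebra_simps)
    from mult_left_mono[OF this edge_weight_nonneg[of x y], of "\<bar>f x - f y\<bar>"]
    show "\<mu> x y * \<bar>f x - f y\<bar> \<le> \<mu> x y + \<mu> x y * (f x - f y)\<^sup>2"
      by (simp add: distrib_left)
  qed (simp add: edge_weight_nonneg)
qed

lemma gradient_summable_signed:
  assumes "finite_energy \<mu> f"
  shows "(\<lambda>y. \<mu> x y * (f x - f y)) summable_on UNIV"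
  using gradient_summable[OF assms, of x]
  by (subst summable_on_iff_abs_summable_on_real) (simp add: abs_mult edge_weight_nonneg)

lemma finite_energy_laplacian_domain:
  assumes "finite_energy \<mu> f"
  shows "f \<in> laplacian_domain \<mu>"
proof -
  have "(\<lambda>y. \<mu> x y * \<bar>f y\<bar>) summable_on UNIV" for x
  proof (rule summable_on_comparison_test)
    show "(\<lambda>y. \<mu> x y * \<bar>f x\<bar> + \<mu> x y * \<bar>f x - f y\<bar>) summable_on UNIV"
      by (intro summable_on_add summable_on_cmult_left edge_weight_summable gradient_summable assms)
    show "\<mu> x y * \<bar>f y\<bar> \<le> \<mu> x y * \<bar>f x\<bar> + \<mu> x y * \<bar>f x - f y\<bar>" for y
      unfolding distrib_left[symmetric] by (rule mult_left_mono) (auto simp: edge_weight_nonneg)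
  qed (simp add: edge_weight_nonneg)
  then show ?thesis by (simp add: laplacian_domain_def)
qed

lemma harmonic_function_iff_net_flow:
  assumes "finite_energy \<mu> f"
  shows "harmonic_function m \<mu> f \<longleftrightarrow> (\<forall>x. net_flow f x = 0)"
proof -
  have "m x \<noteq> 0" for x
    using vertex_weight_pos[of x] by simp
  then show ?thesis
    using finite_energy_laplacian_domain[OF assms]
    by (simp add: harmonic_function_def laplacian_def net_flow_def)
qed

text \<open>Green's formula for the indicator of one vertex: only the edges at \<open>x\<close> contribute, and each of
  them occurs once in either orientation, hence the factor 2. Only summability at \<open>x\<close> is assumed, so that the
  lemma also yields the finite energy of the indicator itself.\<close>

lemma has_sum_energy_form_indicator:
  assumes "(\<lambda>y. \<mu> x y * (f x - f y)) summable_on UNIV"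
  shows "((\<lambda>(a, b). \<mu> a b * ((f a - f b) * (indicator {x} a - indicator {x} b)))
    has_sum 2 * net_flow f x) UNIV"
proof -
  let ?F = "\<lambda>(a, b). \<mu> a b * (f a - f b) * indicator {x} a"
  have "((\<lambda>y. \<mu> x y * (f x - f y)) has_sum net_flow f x) UNIV"
    using assms unfolding net_flow_def by (rule has_sum_infsum)
  then have "(?F has_sum net_flow f x) (range (Pair x))"
    by (subst has_sum_reindex) (auto simp: o_def inj_on_def)
  then have F: "(?F has_sum net_flow f x) UNIV"
    by (rule has_sum_cong_neutral[THEN iffD1, rotated -1]) (auto simp: indicator_def)
  then have F': "((\<lambda>p. ?F (prod.swap p)) has_sum net_flow f x) UNIV"
    by (subst has_sum_reindex_bij_betw[of _ _ UNIV]) auto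
  have "((\<lambda>p. ?F p + ?F (prod.swap p)) has_sum (net_flow f x + net_flow f x)) UNIV"
    by (rule has_sum_add[OF F F'])
  also have "(\<lambda>p. ?F p + ?F (prod.swap p))
      = (\<lambda>(a, b). \<mu> a b * ((f a - f b) * (indicator {x} a - indicator {x} b)))"
  proof
    fix p :: "'v \<times> 'v"
    obtain a b where p: "p = (a, b)" by (cases p)
    show "?F p + ?F (prod.swap p)
        = (\<lambda>(a, b). \<mu> a b * ((f a - f b) * (indicator {x} a - indicator {x} b))) p"
      by (simp add: p edge_weight_sym[of b a]) (simp add: algebra_simps)
  qed
  finally show ?thesis by simp
qed

lemma finite_energy_indicator: "finite_energy \<mu> (indicator {x} :: 'v \<Rightarrow> real)"
proof -
  have "(\<lambda>y. \<mu> x y * (indicator {x} x - indicator {x} y :: real)) summable_on UNIV"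
    by (rule summable_on_comparison_test[OF edge_weight_summable[of x]])
      (auto simp: indicator_def edge_weight_nonneg)
  from has_sum_energy_form_indicator[OF this] show ?thesis
    unfolding finite_energy_real_iff power2_eq_square by (rule has_sum_imp_summable)
qed

lemma energy_form_indicator:
  assumes "finite_energy \<mu> f"
  shows "energy_form f (indicator {x}) = 2 * net_flow f x"
  unfolding energy_form_def
  by (intro infsumI has_sum_energy_form_indicator gradient_summable_signed assms)

text \<open>A finitely supported function is a linear combination of indicators. Its finite energy, without
  which the bilinear form cannot be expanded, is proved along in the same induction.\<close>

lemma Green_formula_aux:
  assumes "finite S" "\<And>x. x \<notin> S \<Longrightarrow> \<phi> x = 0"
  shows "finite_energy \<mu> \<phi>
    \<and> (\<forall>f. finite_energy \<mu> f \<longrightarrow> energy_form f \<phi> = 2 * (\<Sum>x\<in>S. \<phi> x * net_flow f x))"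
  using assms
proof (induction S arbitrary: \<phi>)
  case empty
  then have "\<phi> = (\<lambda>_. 0)" by auto
  then show ?case by (simp add: finite_energy_real_iff energy_form_def case_prod_unfold)
next
  case (insert a S)
  let ?\<psi> = "\<phi>(a := 0)"
  have \<phi>: "\<phi> = (\<lambda>x. ?\<psi> x + \<phi> a * indicator {a} x)"
    by (auto simp: fun_eq_iff indicator_def)
  have "\<And>x. x \<notin> S \<Longrightarrow> ?\<psi> x = 0"
    using insert.prems by simp
  then have IH_all: "finite_energy \<mu> ?\<psi> \<and> (\<forall>f. finite_energy \<mu> f \<longrightarrow>
      energy_form f ?\<psi> = 2 * (\<Sum>x\<in>S. ?\<psi> x * net_flow f x))"
    by (rule insert.IH)
  note IH = IH_all[THEN conjunct1] IH_all[THEN conjunct2, rule_format]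
  have "finite_energy \<mu> (\<lambda>x. ?\<psi> x + \<phi> a * indicator {a} x)"
    by (rule finite_energy_lincomb[OF IH(1) finite_energy_indicator])
  then have "finite_energy \<mu> \<phi>"
    unfolding \<phi>[symmetric] .
  moreover have "energy_form f \<phi> = 2 * (\<Sum>x\<in>insert a S. \<phi> x * net_flow f x)"
    if "finite_energy \<mu> f" for f
  proof -
    have "energy_form f \<phi> = energy_form f (\<lambda>x. ?\<psi> x + \<phi> a * indicator {a} x)"
      using \<phi> by (rule arg_cong)
    also have "\<dots> = energy_form f ?\<psi> + \<phi> a * energy_form f (indicator {a})"
      by (intro energy_form_lincomb_right that IH finite_energy_indicator)
    also have "energy_form f ?\<psi> = 2 * (\<Sum>x\<in>S. \<phi> x * net_flow f x)"
      unfolding IH(2)[OF that] using insert.hyps by (intro arg_cong2[of _ _ _ _ "(*)"] refl sum.cong) auto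
    finally show ?thesis
      using insert.hyps energy_form_indicator[OF that, of a] by simp
  qed
  ultimately show ?case by blast
qed

lemma finite_energy_finitely_supported:
  "finitely_supported \<phi> \<Longrightarrow> finite_energy \<mu> \<phi>"
  using Green_formula_aux[of "{x. \<phi> x \<noteq> 0}" \<phi>] unfolding finitely_supported_def by blast

lemma Green_formula:
  assumes "finite_energy \<mu> f" "finitely_supported \<phi>"
  shows "energy_form f \<phi> = 2 * (\<Sum>x | \<phi> x \<noteq> 0. \<phi> x * net_flow f x)"
  using Green_formula_aux[of "{x. \<phi> x \<noteq> 0}" \<phi>] assms unfolding finitely_supported_def by blast

lemma energy_form_abs_le:
  assumes "finite_energy \<mu> f"
  shows "finite_energy \<mu> (\<lambda>x. \<bar>f x\<bar>)"
    and "energy_form (\<lambda>x. \<bar>f x\<bar>) (\<lambda>x. \<bar>f x\<bar>) \<le> energy_form f f"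
proof -
  have le: "\<bar>\<bar>f x\<bar> - \<bar>f y\<bar>\<bar> \<le> \<bar>f x - f y\<bar>" for x y
    by (rule abs_triangle_ineq3)
  show fin: "finite_energy \<mu> (\<lambda>x. \<bar>f x\<bar>)"
    using assms by (rule finite_energy_mono) (unfold dist_real_def, rule le)
  have sq: "(\<bar>a\<bar> - \<bar>b\<bar>) * (\<bar>a\<bar> - \<bar>b\<bar>) \<le> (a - b) * (a - b)" for a b :: real
    by (rule abs_le_square_iff[THEN iffD1, unfolded power2_eq_square]) simp
  have "(\<lambda>(x, y). \<mu> x y * ((\<bar>f x\<bar> - \<bar>f y\<bar>) * (\<bar>f x\<bar> - \<bar>f y\<bar>))) p
      \<le> (\<lambda>(x, y). \<mu> x y * ((f x - f y) * (f x - f y))) p" for p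
    unfolding case_prod_unfold by (rule mult_left_mono[OF sq edge_weight_nonneg])
  then show "energy_form (\<lambda>x. \<bar>f x\<bar>) (\<lambda>x. \<bar>f x\<bar>) \<le> energy_form f f"
    unfolding energy_form_def
    by (rule infsum_mono[OF energy_form_summable[OF fin fin] energy_form_summable[OF assms assms]])
qed

text \<open>Write \<open>f = f\<^sup>+ - f\<^sup>-\<close>. The positive and negative parts have disjoint supports, so their mixed energy
  is a sum of nonpositive terms. This strengthens the contraction property of the energy.\<close>

lemma energy_form_neg_part_le:
  assumes "finite_energy \<mu> f" "finite_energy \<mu> (\<lambda>x. max 0 (- f x))"
  shows "energy_form f (\<lambda>x. max 0 (- f x))
    \<le> - energy_form (\<lambda>x. max 0 (- f x)) (\<lambda>x. max 0 (- f x))"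
proof -
  let ?g = "\<lambda>x. max 0 (- f x)"
  have le: "(a - b) * (max 0 (- a) - max 0 (- b))
      \<le> (- 1) * ((max 0 (- a) - max 0 (- b)) * (max 0 (- a) - max 0 (- b)))" for a b :: real
  proof (cases "a \<le> 0"; cases "b \<le> 0")
    assume "a \<le> 0" "\<not> b \<le> 0"
    then show ?thesis
      using mult_nonpos_nonneg[of a b] by (simp add: left_diff_distrib right_diff_distrib mult.commute)
  next
    assume "\<not> a \<le> 0" "b \<le> 0"
    then show ?thesis
      using mult_nonneg_nonpos[of a b] by (simp add: left_diff_distrib right_diff_distrib mult.commute)
  qed (simp_all add: algebra_simps)
  have "energy_form f ?g \<le> - 1 * energy_form ?g ?g"
  proof (rule has_sum_mono)
    show "((\<lambda>(x, y). \<mu> x y * ((f x - f y) * (?g x - ?g y))) has_sum energy_form f ?g) UNIV"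
      by (intro has_sum_energy_form assms)
    show "((\<lambda>p. - 1 * (\<lambda>(x, y). \<mu> x y * ((?g x - ?g y) * (?g x - ?g y))) p)
        has_sum - 1 * energy_form ?g ?g) UNIV"
      by (intro has_sum_cmult_right has_sum_energy_form assms)
    fix p
    show "(\<lambda>(x, y). \<mu> x y * ((f x - f y) * (?g x - ?g y))) p
        \<le> - 1 * (\<lambda>(x, y). \<mu> x y * ((?g x - ?g y) * (?g x - ?g y))) p"
      unfolding case_prod_unfold mult.left_commute[of "- 1" "\<mu> (fst p) (snd p)"]
      by (rule mult_left_mono[OF le edge_weight_nonneg])
  qed
  then show ?thesis by simp
qed

lemma energy_form_Cauchy_Schwarz_sqrt:
  assumes "finite_energy \<mu> f" "finite_energy \<mu> g"
  shows "\<bar>energy_form f g\<bar> \<le> sqrt (energy_form f f) * sqrt (energy_form g g)"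
  using real_sqrt_le_mono[OF energy_form_Cauchy_Schwarz[OF assms]]
  by (simp add: real_sqrt_mult)

lemmas finite_energy_add = finite_energy_lincomb[where t = 1, unfolded mult_1]
lemmas finite_energy_diff = finite_energy_lincomb[where t = "-1", unfolded mult_minus1, folded diff_conv_add_uminus]
lemmas finitely_supported_diff =
  finitely_supported_lincomb[where t = "-1", unfolded mult_minus1, folded diff_conv_add_uminus]
lemmas energy_form_add_right = energy_form_lincomb_right[where t = 1, unfolded mult_1]
lemmas energy_form_diff_right =
  energy_form_lincomb_right[where t = "-1", unfolded mult_minus1, folded diff_conv_add_uminus]


section \<open>Harmonic majorants\<close>

lemma energy_form_subharmonic_nonpos:
  assumes "finite_energy \<mu> f" "\<And>x. net_flow f x \<le> 0" "finitely_supported \<psi>" "\<And>x. 0 \<le> \<psi> x"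
  shows "energy_form f \<psi> \<le> 2 * \<psi> x0 * net_flow f x0"
proof -
  have terms: "\<psi> x * net_flow f x \<le> 0" for x
    using assms(2,4) by (rule mult_nonneg_nonpos[rotated])
  have "(\<Sum>x | \<psi> x \<noteq> 0. \<psi> x * net_flow f x) \<le> \<psi> x0 * net_flow f x0"
  proof (cases "\<psi> x0 = 0")
    case True
    then show ?thesis
      using sum_nonpos[of "{x. \<psi> x \<noteq> 0}", OF terms] by simp
  next
    case False
    then have "- (\<psi> x0 * net_flow f x0) \<le> (\<Sum>x | \<psi> x \<noteq> 0. - (\<psi> x * net_flow f x))"
      using assms(3) terms unfolding finitely_supported_def
      by (intro member_le_sum[where f = "\<lambda>x. - (\<psi> x * net_flow f x)"]) auto
    then show ?thesis by (simp add: sum_negf)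
  qed
  then show ?thesis
    unfolding Green_formula[OF assms(1,3)] by simp
qed

text \<open>Let \<open>\<psi>\<close> be the negative part of \<open>\<phi>\<close>. Passing from \<open>f + \<phi>\<close> to \<open>f + \<phi> + \<psi>\<close> adds
  \<open>2 E(f, \<psi>) + 2 E(\<phi>, \<psi>) + E(\<psi>, \<psi>)\<close> to the energy form \<open>E\<close>. The first term is nonpositive because \<open>f\<close> is
  subharmonic, and the second is at most \<open>- 2 E(\<psi>, \<psi>)\<close>.\<close>

lemma energy_form_pos_part_le:
  assumes f: "finite_energy \<mu> f" "\<And>x. net_flow f x \<le> 0" and \<phi>: "finitely_supported \<phi>"
  shows "finitely_supported (\<lambda>x. max 0 (\<phi> x))"
    and "energy_form (\<lambda>x. f x + max 0 (\<phi> x)) (\<lambda>x. f x + max 0 (\<phi> x))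
      \<le> energy_form (\<lambda>x. f x + \<phi> x) (\<lambda>x. f x + \<phi> x)"
proof -
  let ?\<psi> = "\<lambda>x. max 0 (- \<phi> x)" and ?g = "\<lambda>x. f x + \<phi> x"
  have sub: "{x. max 0 (\<phi> x) \<noteq> 0} \<subseteq> {x. \<phi> x \<noteq> 0}" "{x. ?\<psi> x \<noteq> 0} \<subseteq> {x. \<phi> x \<noteq> 0}"
    by auto
  show "finitely_supported (\<lambda>x. max 0 (\<phi> x))"
    using \<phi> finite_subset[OF sub(1)] unfolding finitely_supported_def by simp
  have \<psi>: "finitely_supported ?\<psi>"
    using \<phi> finite_subset[OF sub(2)] unfolding finitely_supported_def by simp
  note fin = f(1) finite_energy_finitely_supported[OF \<phi>] finite_energy_finitely_supported[OF \<psi>]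
  have "max 0 (- \<phi> x) + \<phi> x = max 0 (\<phi> x)" for x
    by simp
  then have eq: "(\<lambda>x. f x + max 0 (\<phi> x)) = (\<lambda>x. ?g x + 1 * ?\<psi> x)"
    by (auto simp: fun_eq_iff)
  have "energy_form f ?\<psi> \<le> 0"
    using energy_form_subharmonic_nonpos[OF f \<psi>, of undefined] f(2)
    by (smt (verit) max.cobounded1 mult_nonneg_nonpos)
  moreover have "energy_form \<phi> ?\<psi> \<le> - energy_form ?\<psi> ?\<psi>"
    by (intro energy_form_neg_part_le fin)
  moreover have "energy_form ?g ?\<psi> = energy_form f ?\<psi> + energy_form \<phi> ?\<psi>"
    unfolding energy_form_commute[of _ ?\<psi>] by (rule energy_form_add_right[OF fin(3,1,2)])
  ultimately show "energy_form (\<lambda>x. f x + max 0 (\<phi> x)) (\<lambda>x. f x + max 0 (\<phi> x)) \<le> energy_form ?g ?g"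
    unfolding eq energy_form_lincomb_square[OF finite_energy_add[OF fin(1,2)] fin(3)]
    using energy_form_nonneg[of ?\<psi>] by simp
qed

text \<open>A strictly subharmonic vertex makes the graph transient. Testing \<open>f\<close> against \<open>\<bar>\<phi>\<bar>\<close> in Green's formula
  leaves at least the term at \<open>x0\<close>, while Cauchy-Schwarz bounds the result by the energies; the values at
  other vertices are compared with the one at \<open>x0\<close>.\<close>

lemma energy_control_test_functions:
  assumes conn: "connected_graph \<mu>"
    and f: "finite_energy \<mu> f" "\<And>x. net_flow f x \<le> 0" and strict: "net_flow f x0 < 0"
  shows "\<exists>C\<ge>0. \<forall>\<phi>. finitely_supported \<phi> \<longrightarrow> \<bar>\<phi> x\<bar> \<le> C * sqrt (energy_form \<phi> \<phi>)"
proof -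
  obtain C where C: "C \<ge> 0"
    "\<And>f. finite_energy \<mu> f \<Longrightarrow> \<bar>f x - f x0\<bar> \<le> C * sqrt (energy_form f f)"
    using energy_control_between[OF conn, of x x0] by blast
  define c where "c = - 2 * net_flow f x0"
  define K where "K = sqrt (energy_form f f) / c"
  have "c > 0" using strict by (simp add: c_def)
  then have "K \<ge> 0" by (simp add: K_def energy_form_nonneg)
  have "\<bar>\<phi> x\<bar> \<le> (C + K) * sqrt (energy_form \<phi> \<phi>)" if \<phi>: "finitely_supported \<phi>" for \<phi>
  proof -
    let ?\<psi> = "\<lambda>x. \<bar>\<phi> x\<bar>"
    have \<psi>: "finitely_supported ?\<psi>"
      using \<phi> by (simp add: finitely_supported_def)
    note fin = f(1) finite_energy_finitely_supported[OF \<phi>] finite_energy_finitely_supported[OF \<psi>]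
    have "c * ?\<psi> x0 \<le> - energy_form f ?\<psi>"
      using energy_form_subharmonic_nonpos[OF f \<psi>, of x0] by (simp add: c_def mult_ac)
    also have "\<dots> \<le> sqrt (energy_form f f) * sqrt (energy_form ?\<psi> ?\<psi>)"
      using energy_form_Cauchy_Schwarz_sqrt[OF fin(1,3)] by simp
    also have "\<dots> \<le> sqrt (energy_form f f) * sqrt (energy_form \<phi> \<phi>)"
      by (intro mult_left_mono real_sqrt_le_mono energy_form_abs_le fin) (simp add: energy_form_nonneg)
    finally have "\<bar>\<phi> x0\<bar> \<le> K * sqrt (energy_form \<phi> \<phi>)"
      using \<open>c > 0\<close> unfolding K_def by (simp add: pos_le_divide_eq mult.commute)
    with C(2)[OF fin(2)] show ?thesis
      by (simp add: distrib_right)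
  qed
  with C(1) \<open>K \<ge> 0\<close> show ?thesis
    by (intro exI[of _ "C + K"]) simp
qed

text \<open>The parallelogram argument: the midpoint of two near-minimizers has energy at least the infimum, which
  leaves no room for their difference.\<close>

lemma near_minimizers_close:
  assumes f: "finite_energy \<mu> f"
    and min: "\<And>\<phi>. finitely_supported \<phi> \<Longrightarrow> I \<le> energy_form (\<lambda>x. f x + \<phi> x) (\<lambda>x. f x + \<phi> x)"
    and \<phi>: "finitely_supported \<phi>" "energy_form (\<lambda>x. f x + \<phi> x) (\<lambda>x. f x + \<phi> x) \<le> I + \<delta>"
    and \<psi>: "finitely_supported \<psi>" "energy_form (\<lambda>x. f x + \<psi> x) (\<lambda>x. f x + \<psi> x) \<le> I + \<epsilon>"
  shows "energy_form (\<lambda>x. \<psi> x - \<phi> x) (\<lambda>x. \<psi> x - \<phi> x) \<le> 2 * \<delta> + 2 * \<epsilon>"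
proof -
  let ?g = "\<lambda>x. f x + \<phi> x" and ?d = "\<lambda>x. \<psi> x - \<phi> x"
  have d: "finitely_supported ?d"
    by (rule finitely_supported_diff[OF \<psi>(1) \<phi>(1)])
  note fin = finite_energy_add[OF f finite_energy_finitely_supported[OF \<phi>(1)]]
    finite_energy_finitely_supported[OF d]
  have "(\<lambda>x. ?g x + 1 / 2 * ?d x) = (\<lambda>x. f x + (\<phi> x + 1 / 2 * ?d x))"
    "(\<lambda>x. ?g x + 1 * ?d x) = (\<lambda>x. f x + \<psi> x)"
    by (simp_all add: fun_eq_iff)
  then have "I \<le> energy_form (\<lambda>x. ?g x + 1 / 2 * ?d x) (\<lambda>x. ?g x + 1 / 2 * ?d x)"
    "energy_form (\<lambda>x. ?g x + 1 * ?d x) (\<lambda>x. ?g x + 1 * ?d x) \<le> I + \<epsilon>"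
    using min[OF finitely_supported_lincomb[OF \<phi>(1) d, of "1 / 2"]] \<psi>(2) by simp_all
  then show ?thesis
    unfolding energy_form_lincomb_square[OF fin] using \<phi>(2) by (simp add: power2_eq_square)
qed

text \<open>The quantitative Euler-Lagrange equation: the quadratic polynomial \<open>t \<mapsto> E(f + \<phi> + t \<psi>) - I\<close> is nonnegative
  and at most \<open>\<epsilon>\<close> at \<open>t = 0\<close>, so its discriminant bounds the linear coefficient.\<close>

lemma near_minimizer_near_harmonic:
  assumes f: "finite_energy \<mu> f"
    and min: "\<And>\<phi>. finitely_supported \<phi> \<Longrightarrow> I \<le> energy_form (\<lambda>x. f x + \<phi> x) (\<lambda>x. f x + \<phi> x)"
    and \<phi>: "finitely_supported \<phi>" "energy_form (\<lambda>x. f x + \<phi> x) (\<lambda>x. f x + \<phi> x) \<le> I + \<epsilon>"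
    and \<psi>: "finitely_supported \<psi>"
  shows "\<bar>energy_form (\<lambda>x. f x + \<phi> x) \<psi>\<bar> \<le> sqrt \<epsilon> * sqrt (energy_form \<psi> \<psi>)"
proof -
  let ?g = "\<lambda>x. f x + \<phi> x"
  note fin = finite_energy_add[OF f finite_energy_finitely_supported[OF \<phi>(1)]]
    finite_energy_finitely_supported[OF \<psi>]
  have "0 \<le> \<epsilon> + 2 * t * energy_form ?g \<psi> + t\<^sup>2 * energy_form \<psi> \<psi>" for t
  proof -
    have "I \<le> energy_form (\<lambda>x. f x + (\<phi> x + t * \<psi> x)) (\<lambda>x. f x + (\<phi> x + t * \<psi> x))"
      by (intro min finitely_supported_lincomb \<phi>(1) \<psi>)
    then show ?thesis
      using \<phi>(2) energy_form_lincomb_square[OF fin, of t] by (simp add: add.assoc)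
  qed
  then have "(energy_form ?g \<psi>)\<^sup>2 \<le> \<epsilon> * energy_form \<psi> \<psi>"
    by (rule discriminant_nonpos) (rule energy_form_nonneg)
  from real_sqrt_le_mono[OF this] show ?thesis
    by (simp add: real_sqrt_mult)
qed

text \<open>In the case where \<open>f\<close> is not harmonic, nonnegative near-minimizers \<open>\<phi> n\<close> converge pointwise to some
  \<open>l\<close>, and Fatou's lemma upgrades this to convergence in energy. Hence the almost harmonicity of
  \<open>f + \<phi> n\<close> becomes harmonicity of \<open>f + l\<close>.\<close>

theorem harmonic_majorant:
  assumes conn: "connected_graph \<mu>"
    and f: "finite_energy \<mu> f" "\<And>x. net_flow f x \<le> 0"
  obtains h where "finite_energy \<mu> h" "\<And>x. net_flow h x = 0" "\<And>x. f x \<le> h x"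
proof (cases "\<forall>x. net_flow f x = 0")
  case True
  then show ?thesis using f(1) that by blast
next
  case False
  then obtain x0 where strict: "net_flow f x0 < 0"
    using f(2) by (metis order_le_less)
  let ?E = "\<lambda>\<phi>. energy_form (\<lambda>x. f x + \<phi> x) (\<lambda>x. f x + \<phi> x)"
  define I where "I = Inf (?E ` Collect finitely_supported)"
  define \<epsilon> where "\<epsilon> n = 1 / real (Suc n)" for n
  have "finitely_supported (\<lambda>_. 0)"
    by (simp add: finitely_supported_def)
  then have ne: "?E ` Collect finitely_supported \<noteq> {}"
    by blast
  have min: "I \<le> ?E \<phi>" if "finitely_supported \<phi>" for \<phi>
    unfolding I_def using that by (intro cInf_lower bdd_belowI2[of _ 0] energy_form_nonneg) auto
  have \<epsilon>_pos: "0 < \<epsilon> n" for n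
    by (simp add: \<epsilon>_def)
  have \<epsilon>_mono: "\<epsilon> m \<le> \<epsilon> n" if "n \<le> m" for m n
    using that by (simp add: \<epsilon>_def frac_le)
  have \<epsilon>_lim: "(\<lambda>n. K * sqrt (\<epsilon> n)) \<longlonglongrightarrow> 0" for K
  proof -
    have "\<epsilon> \<longlonglongrightarrow> 0"
      unfolding \<epsilon>_def by (rule LIMSEQ_Suc[OF lim_1_over_n])
    then have "(\<lambda>n. K * sqrt (\<epsilon> n)) \<longlonglongrightarrow> K * sqrt 0"
      by (intro tendsto_intros)
    then show ?thesis by simp
  qed
  have "\<exists>\<phi>. finitely_supported \<phi> \<and> (\<forall>x. 0 \<le> \<phi> x) \<and> ?E \<phi> \<le> I + \<epsilon> n" for n
  proof -
    obtain \<phi> where \<phi>: "finitely_supported \<phi>" "?E \<phi> < I + \<epsilon> n"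
      using cInf_lessD[OF ne, of "I + \<epsilon> n"] \<epsilon>_pos[of n] unfolding I_def[symmetric] by auto
    show ?thesis
      using energy_form_pos_part_le[OF f \<phi>(1)] \<phi>(2)
      by (intro exI[of _ "\<lambda>x. max 0 (\<phi> x)"]) auto
  qed
  then obtain \<phi> where \<phi>: "\<And>n. finitely_supported (\<phi> n)" "\<And>n x. 0 \<le> \<phi> n x"
    "\<And>n. ?E (\<phi> n) \<le> I + \<epsilon> n"
    by metis
  let ?d = "\<lambda>n m x. \<phi> n x - \<phi> m x"
  have close: "energy_form (?d n m) (?d n m) \<le> 4 * \<epsilon> n" if "n \<le> m" for n m
    using near_minimizers_close[OF f(1) min \<phi>(1,3)[of m] \<phi>(1,3)[of n]] \<epsilon>_mono[OF that] by simp
  have "\<exists>l. (\<lambda>n. \<phi> n x) \<longlonglongrightarrow> l" for x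
  proof -
    obtain C where C: "C \<ge> 0"
      "\<And>\<phi>. finitely_supported \<phi> \<Longrightarrow> \<bar>\<phi> x\<bar> \<le> C * sqrt (energy_form \<phi> \<phi>)"
      using energy_control_test_functions[OF conn f strict, of x] by blast
    have bound: "\<bar>\<phi> n x - \<phi> m x\<bar> \<le> C * 2 * sqrt (\<epsilon> n)" if "n \<le> m" for n m
    proof -
      have "\<bar>?d n m x\<bar> \<le> C * sqrt (energy_form (?d n m) (?d n m))"
        by (rule C(2)[OF finitely_supported_diff[OF \<phi>(1) \<phi>(1)]])
      also have "\<dots> \<le> C * sqrt (4 * \<epsilon> n)"
        by (intro mult_left_mono real_sqrt_le_mono close that C(1))
      finally show ?thesis by (simp add: real_sqrt_mult)
    qed
    have "Cauchy (\<lambda>n. \<phi> n x)"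
    proof (rule metric_CauchyI)
      fix e :: real assume "0 < e"
      then obtain N where "C * 2 * sqrt (\<epsilon> N) < e / 2"
        using order_tendstoD(2)[OF \<epsilon>_lim[of "C * 2"], of "e / 2"]
        by (auto simp: eventually_sequentially)
      then have "dist (\<phi> m x) (\<phi> n x) < e" if "m \<ge> N" "n \<ge> N" for m n
        using bound[OF that(1)] bound[OF that(2)] by (simp add: dist_real_def)
      then show "\<exists>M. \<forall>m\<ge>M. \<forall>n\<ge>M. dist (\<phi> m x) (\<phi> n x) < e" by blast
    qed
    then show ?thesis
      using Cauchy_convergent convergent_def by blast
  qed
  then obtain l where l: "\<And>x. (\<lambda>n. \<phi> n x) \<longlonglongrightarrow> l x"
    by metis
  let ?r = "\<lambda>n x. \<phi> n x - l x" and ?h = "\<lambda>x. f x + l x"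
  \<comment> \<open>Fix \<open>n\<close> and let \<open>m\<close> tend to infinity in the bound on \<open>?d n m\<close>.\<close>
  have r: "finite_energy \<mu> (?r n)" "energy_form (?r n) (?r n) \<le> 4 * \<epsilon> n" for n
  proof -
    have 1: "finite_energy \<mu> (?d n m)" for m
      by (rule finite_energy_finitely_supported[OF finitely_supported_diff[OF \<phi>(1) \<phi>(1)]])
    have 2: "(\<lambda>m. ?d n m x) \<longlonglongrightarrow> ?r n x" for x
      by (intro tendsto_intros l)
    have 3: "\<forall>\<^sub>F m in sequentially. energy_form (?d n m) (?d n m) \<le> 4 * \<epsilon> n"
      unfolding eventually_sequentially using close by blast
    show "finite_energy \<mu> (?r n)" "energy_form (?r n) (?r n) \<le> 4 * \<epsilon> n"
      by (fact energy_form_lower_semicontinuous[OF 1 2 3])+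
  qed
  have g: "finite_energy \<mu> (\<lambda>x. f x + \<phi> n x)" for n
    by (intro finite_energy_add f(1) finite_energy_finitely_supported \<phi>)
  have h_eq: "?h = (\<lambda>x. (f x + \<phi> n x) - ?r n x)" for n
    by (simp add: fun_eq_iff)
  have h: "finite_energy \<mu> ?h"
    unfolding h_eq[of 0] by (rule finite_energy_diff[OF g r(1)])
  have "net_flow ?h x = 0" for x
  proof -
    let ?\<delta> = "indicator {x} :: 'v \<Rightarrow> real"
    have \<delta>: "finitely_supported ?\<delta>"
      by (simp add: finitely_supported_def indicator_def)
    \<comment> \<open>Near-minimality of \<open>\<phi> n\<close> contributes one multiple of \<open>sqrt (\<epsilon> n)\<close>, its distance to \<open>l\<close> two.\<close>
    have "\<bar>energy_form ?h ?\<delta>\<bar> \<le> 3 * sqrt (energy_form ?\<delta> ?\<delta>) * sqrt (\<epsilon> n)" for n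
    proof -
      have "energy_form ?h ?\<delta> = energy_form (\<lambda>x. f x + \<phi> n x) ?\<delta> - energy_form (?r n) ?\<delta>"
        unfolding energy_form_commute[of _ ?\<delta>] h_eq[of n]
        by (rule energy_form_diff_right[OF finite_energy_indicator g r(1)])
      moreover have "\<bar>energy_form (\<lambda>x. f x + \<phi> n x) ?\<delta>\<bar> \<le> sqrt (\<epsilon> n) * sqrt (energy_form ?\<delta> ?\<delta>)"
        by (rule near_minimizer_near_harmonic[OF f(1) min \<phi>(1,3) \<delta>])
      moreover have "\<bar>energy_form (?r n) ?\<delta>\<bar> \<le> 2 * sqrt (\<epsilon> n) * sqrt (energy_form ?\<delta> ?\<delta>)"
      proof -
        have "\<bar>energy_form (?r n) ?\<delta>\<bar> \<le> sqrt (energy_form (?r n) (?r n)) * sqrt (energy_form ?\<delta> ?\<delta>)"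
          by (rule energy_form_Cauchy_Schwarz_sqrt[OF r(1) finite_energy_indicator])
        also have "\<dots> \<le> sqrt (4 * \<epsilon> n) * sqrt (energy_form ?\<delta> ?\<delta>)"
          by (intro mult_right_mono real_sqrt_le_mono r) (simp add: energy_form_nonneg)
        finally show ?thesis by (simp add: real_sqrt_mult)
      qed
      ultimately show ?thesis by (simp add: mult_ac abs_le_iff)
    qed
    then have "\<bar>energy_form ?h ?\<delta>\<bar> \<le> 0"
      by (intro LIMSEQ_le_const[OF \<epsilon>_lim]) blast
    then show ?thesis
      using energy_form_indicator[OF h, of x] by simp
  qed
  moreover have "f x \<le> ?h x" for x
    using LIMSEQ_le_const[OF l, of 0 x] \<phi>(2) by auto
  ultimately show ?thesis
    using h that by blast
qed

end


section \<open>Jensen's inequality for barycenters\<close>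

text \<open>The side \<open>0 q'\<close> is put on the first axis. The first coordinate \<open>a\<close> of \<open>r'\<close> is given by the law of
  cosines, and the triangle inequalities say exactly that \<open>\<bar>a\<bar> \<le> r\<close>. The last conclusion is Stewart's
  theorem for the points of the line through that side.\<close>

lemma comparison_triangle_exists:
  fixes r D e :: real
  assumes "0 < D" "\<bar>r - D\<bar> \<le> e" "e \<le> r + D"
  obtains q' r' :: "real^2" where "dist 0 q' = D" "dist 0 r' = r" "dist q' r' = e"
    "\<And>t. (dist (t *\<^sub>R q') r')\<^sup>2 = r\<^sup>2 + (t * D)\<^sup>2 - t * (r\<^sup>2 + D\<^sup>2 - e\<^sup>2)"
proof -
  define a where "a = (r\<^sup>2 + D\<^sup>2 - e\<^sup>2) / (2 * D)"
  have Da: "2 * D * a = r\<^sup>2 + D\<^sup>2 - e\<^sup>2"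
    using assms(1) by (simp add: a_def)
  have nonneg: "0 \<le> e" "0 \<le> r"
    using assms by auto
  have "\<bar>r - D\<bar>\<^sup>2 \<le> e\<^sup>2" "e\<^sup>2 \<le> (r + D)\<^sup>2"
    using power_mono[OF assms(2), of 2] power_mono[OF assms(3) nonneg(1), of 2] by simp_all
  then have le: "2 * D * a \<le> 2 * D * r" "2 * D * (- r) \<le> 2 * D * a"
    unfolding Da by (simp_all add: power2_eq_square algebra_simps)
  have "a \<le> r" "- r \<le> a"
    using assms(1) by (auto intro: mult_left_le_imp_le[OF le(1)] mult_left_le_imp_le[OF le(2)])
  then have "\<bar>a\<bar> \<le> r"
    by simp
  then have "\<bar>a\<bar>\<^sup>2 \<le> r\<^sup>2"
    by (intro power_mono) auto
  then have a: "(sqrt (r\<^sup>2 - a\<^sup>2))\<^sup>2 = r\<^sup>2 - a\<^sup>2"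
    by simp
  let ?q = "vector [D, 0] :: real^2" and ?r = "vector [a, sqrt (r\<^sup>2 - a\<^sup>2)] :: real^2"
  have dist2: "(dist v w)\<^sup>2 = (v $ 1 - w $ 1)\<^sup>2 + (v $ 2 - w $ 2)\<^sup>2" for v w :: "real^2"
    unfolding dist_norm power2_norm_eq_inner
    by (simp add: inner_vec_def sum_2 power2_eq_square)
  have d: "(dist (t *\<^sub>R ?q) ?r)\<^sup>2 = r\<^sup>2 + (t * D)\<^sup>2 - t * (r\<^sup>2 + D\<^sup>2 - e\<^sup>2)" for t
    unfolding dist2 Da[symmetric] by (simp add: a power2_diff)
  have "(dist 0 ?q)\<^sup>2 = D\<^sup>2" "(dist 0 ?r)\<^sup>2 = r\<^sup>2" "(dist ?q ?r)\<^sup>2 = e\<^sup>2"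
    unfolding dist2[of 0] using d[of 1] by (simp_all add: a)
  then have "dist 0 ?q = D" "dist 0 ?r = r" "dist ?q ?r = e"
    using assms(1) nonneg by (auto intro: power2_eq_imp_eq)
  with d that show ?thesis by blast
qed

text \<open>Let \<open>c\<close> divide a geodesic from \<open>b\<close> to \<open>z\<close> in the ratio \<open>t : 1 - t\<close>. In the Euclidean plane the squared
  distance to \<open>y\<close> changes by \<open>- 2 t D a + t\<^sup>2 D\<^sup>2\<close>, where \<open>D = d(b, z)\<close> and \<open>a\<close> is the component of
  \<open>y - b\<close> in the direction of \<open>z\<close>. As \<open>D - a \<le> d(z, y)\<close>, this is bounded in terms of the distance from
  \<open>y\<close> to \<open>z\<close> alone, and comparison transfers the bound. Unlike the usual convexity of
  the squared distance, it is linear in the distance to \<open>z\<close>.\<close>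

lemma hadamard_move_towards:
  fixes b z :: "'y::metric_space"
  assumes "hadamard_space (UNIV :: 'y set)" and t: "0 \<le> t" "t \<le> 1"
  shows "\<exists>c. \<forall>y. (dist c y)\<^sup>2
    \<le> (dist b y)\<^sup>2 + 2 * t * dist b z * (dist y z - dist b z) + t\<^sup>2 * (dist b z)\<^sup>2"
proof (cases "b = z")
  case True
  then show ?thesis by auto
next
  case False
  define D where "D = dist b z"
  have D: "0 < D" using False by (simp add: D_def)
  have geo: "\<exists>S. geodesic_segment p q S" for p q :: 'y
    using assms(1) by (auto simp: hadamard_space_def geodesic_space_def)
  obtain S where S: "geodesic_segment b z S"
    using geo by blast
  then obtain c where c: "c 0 = b" "\<And>s s'. s \<in> {0..D} \<Longrightarrow> s' \<in> {0..D} \<Longrightarrow> dist (c s) (c s') = \<bar>s - s'\<bar>"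
    "S = c ` {0..D}"
    unfolding geodesic_segment_def D_def by blast
  have tD: "t * D \<in> {0..D}"
    using t D by (simp add: mult_left_le_one_le)
  have "(dist (c (t * D)) y)\<^sup>2 \<le> (dist b y)\<^sup>2 + 2 * t * D * (dist y z - D) + t\<^sup>2 * D\<^sup>2" for y
  proof -
    define r e where "r = dist b y" and "e = dist z y"
    obtain T U where TU: "geodesic_segment b y T" "geodesic_segment z y U"
      using geo by blast
    have y: "y \<in> T"
    proof -
      obtain c' where "c' (dist b y) = y" "T = c' ` {0..dist b y}"
        using TU(1) unfolding geodesic_segment_def by blast
      then show ?thesis by (metis atLeastAtMost_iff image_eqI order_refl zero_le_dist)
    qed
    have tri: "\<bar>r - D\<bar> \<le> e" "e \<le> r + D"
      unfolding r_def e_def D_def by (smt (verit) dist_commute dist_triangle)+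
    obtain q' r' :: "real^2" where q'r': "dist 0 q' = D" "dist 0 r' = r" "dist q' r' = e"
      "\<And>t. (dist (t *\<^sub>R q') r')\<^sup>2 = r\<^sup>2 + (t * D)\<^sup>2 - t * (r\<^sup>2 + D\<^sup>2 - e\<^sup>2)"
      using comparison_triangle_exists[OF D tri] by blast
    have x': "t *\<^sub>R q' \<in> closed_segment 0 q'"
      using t by (auto simp: closed_segment_def)
    have "dist b (c (t * D)) = t * D"
      using c(2)[OF _ tD, of 0] c(1) t D by simp
    then have px: "dist 0 (t *\<^sub>R q') = dist b (c (t * D))"
      using q'r'(1) t by simp
    have cat: "CAT0 (UNIV :: 'y set)"
      using assms(1) by (simp add: hadamard_space_def)
    have "dist (c (t * D)) y \<le> dist (t *\<^sub>R q') r'"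
      using cat[unfolded CAT0_def, rule_format, of b z y S T U 0 q' r' "c (t * D)" y "t *\<^sub>R q'" r']
        S TU q'r'(1-3) tD y x' px
      by (auto simp: c(3) r_def e_def D_def)
    then have "(dist (c (t * D)) y)\<^sup>2 \<le> (dist (t *\<^sub>R q') r')\<^sup>2"
      by (simp add: power_mono)
    \<comment> \<open>The two sides differ by \<open>t\<close> times the square of \<open>r\<close> minus that of \<open>e - D\<close>.\<close>
    also have "\<dots> \<le> r\<^sup>2 + 2 * t * D * (e - D) + t\<^sup>2 * D\<^sup>2"
    proof -
      have "\<bar>e - D\<bar>\<^sup>2 \<le> r\<^sup>2"
        using tri by (intro power_mono) (auto simp: abs_le_iff)
      then have "0 \<le> t * (r\<^sup>2 - (e - D)\<^sup>2)"
        using t by simp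
      then show ?thesis
        unfolding q'r'(4) by (simp add: power2_eq_square algebra_simps)
    qed
    finally show ?thesis
      by (simp add: r_def e_def dist_commute)
  qed
  then show ?thesis
    unfolding D_def by blast
qed

text \<open>If the mean distance \<open>J\<close> to \<open>z\<close> were smaller than \<open>D = d(b, z)\<close>, moving \<open>b\<close> towards \<open>z\<close>
  would lower the second moment.\<close>

theorem barycenter_dist_le_integral:
  fixes \<nu> :: "'y::metric_space measure"
  assumes H: "hadamard_space (UNIV :: 'y set)" and b: "is_barycenter \<nu> b"
  shows "dist b z \<le> (LINT y|\<nu>. dist y z)"
proof (rule ccontr)
  define D J where "D = dist b z" and "J = (LINT y|\<nu>. dist y z)"
  assume "\<not> ?thesis"
  then have less: "J < D" by (simp add: D_def J_def)
  have \<nu>: "prob_space \<nu>" "\<And>y0. integrable \<nu> (\<lambda>y. dist y y0)"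
    using b by (auto simp: is_barycenter_def P1_def)
  interpret prob_space \<nu> by (fact \<nu>(1))
  have "0 \<le> J"
    unfolding J_def by (rule integral_nonneg_AE) simp
  with less have D: "0 < D" by simp
  \<comment> \<open>The minimizer of the upper bound \<open>2 * t * D * (J - D) + t\<^sup>2 * D\<^sup>2\<close> for the change.\<close>
  define t where "t = (D - J) / D"
  have t: "0 < t" "t \<le> 1"
    using less D \<open>0 \<le> J\<close> by (auto simp: t_def)
  obtain c where c: "\<And>y. (dist c y)\<^sup>2
      \<le> (dist b y)\<^sup>2 + 2 * t * D * (dist y z - D) + t\<^sup>2 * D\<^sup>2"
    using hadamard_move_towards[OF H, of t b z] t unfolding D_def by auto
  have int: "integrable \<nu> (\<lambda>y. dist w y)" for w
    using \<nu>(2)[of w] by (simp add: dist_commute)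
  note [measurable] = borel_measurable_integrable[OF int]
  have int_diff: "integrable \<nu> (\<lambda>y. (dist c y)\<^sup>2 - (dist b y)\<^sup>2)"
  proof (rule Bochner_Integration.integrable_bound)
    show "integrable \<nu> (\<lambda>y. dist c b * (dist c y + dist b y))"
      by (intro integrable_mult_right Bochner_Integration.integrable_add int)
    have "\<bar>(dist c y)\<^sup>2 - (dist b y)\<^sup>2\<bar> \<le> dist c b * (dist c y + dist b y)" for y
    proof -
      have "(dist c y)\<^sup>2 - (dist b y)\<^sup>2 = (dist c y - dist b y) * (dist c y + dist b y)"
        by (simp add: power2_eq_square algebra_simps)
      moreover have "\<bar>dist c y - dist b y\<bar> \<le> dist c b"
        using dist_triangle[of c y b] dist_triangle[of b y c] by (simp add: dist_commute abs_le_iff)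
      ultimately show ?thesis
        by (simp add: abs_mult mult_right_mono)
    qed
    then show "AE y in \<nu>. norm ((dist c y)\<^sup>2 - (dist b y)\<^sup>2) \<le> norm (dist c b * (dist c y + dist b y))"
      by (simp add: abs_mult)
  qed measurable
  have "0 \<le> (LINT y|\<nu>. (dist c y)\<^sup>2 - (dist b y)\<^sup>2)"
  proof (cases "c = b")
    case False
    then have "(LINT y|\<nu>. (dist b y)\<^sup>2 - (dist b y)\<^sup>2) < (LINT y|\<nu>. (dist c y)\<^sup>2 - (dist b y)\<^sup>2)"
      using b unfolding is_barycenter_def by blast
    then show ?thesis by simp
  qed simp
  also have "\<dots> \<le> (LINT y|\<nu>. 2 * t * D * (dist y z - D) + t\<^sup>2 * D\<^sup>2)"
  proof (rule integral_mono[OF int_diff])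
    show "integrable \<nu> (\<lambda>y. 2 * t * D * (dist y z - D) + t\<^sup>2 * D\<^sup>2)"
      by (intro Bochner_Integration.integrable_add integrable_mult_right
          Bochner_Integration.integrable_diff \<nu>(2)) simp_all
    show "(dist c y)\<^sup>2 - (dist b y)\<^sup>2 \<le> 2 * t * D * (dist y z - D) + t\<^sup>2 * D\<^sup>2" for y
      using c[of y] by simp
  qed
  also have "\<dots> = 2 * t * D * (J - D) + t\<^sup>2 * D\<^sup>2"
    using \<nu>(2)[of z] by (simp add: J_def prob_space)
  also have "\<dots> = - ((D - J)\<^sup>2)"
    using D by (simp add: t_def power2_eq_square field_simps)
  also have "\<dots> < 0"
    using less by simp
  finally show False by simp
qed


section \<open>Harmonic maps\<close>

context weighted_graph
begin

lemma harmonic_map_dist_subharmonic: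
  fixes u :: "'v \<Rightarrow> 'y::metric_space"
  assumes H: "hadamard_space (UNIV :: 'y set)" and u: "harmonic_map \<mu> u" and "finite_energy \<mu> u"
  shows "finite_energy \<mu> (\<lambda>x. dist (u x) z)" and "net_flow (\<lambda>x. dist (u x) z) x \<le> 0"
proof -
  let ?f = "\<lambda>x. dist (u x) z"
  show fin: "finite_energy \<mu> ?f"
    using assms(3)
  proof (rule finite_energy_mono)
    show "dist (?f x) (?f y) \<le> dist (u x) (u y)" for x y
      using dist_triangle[of "u x" z "u y"] dist_triangle[of "u y" z "u x"]
      by (simp add: dist_real_def dist_commute abs_le_iff)
  qed
  define s where "s = (\<Sum>\<^sub>\<infinity>y\<in>UNIV. \<mu> x y)"
  let ?P = "transition_prob \<mu> x" and ?\<nu> = "distr (transition_measure \<mu> x) borel u"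
  have b: "is_barycenter ?\<nu> (u x)"
    using u by (simp add: harmonic_map_def)
  \<comment> \<open>At an isolated vertex the transition measure vanishes, whereas barycenters are only defined for
    probability measures.\<close>
  have "s \<noteq> 0"
  proof
    assume "s = 0"
    then have "?P y = 0" for y
      by (simp add: transition_prob_def s_def)
    then have "emeasure (transition_measure \<mu> x) A = 0" for A
      by (simp add: transition_measure_def emeasure_density)
    then have "emeasure ?\<nu> (space ?\<nu>) = 0"
      by (simp add: emeasure_distr transition_measure_def)
    moreover have "prob_space ?\<nu>"
      using b by (simp add: is_barycenter_def P1_def)
    ultimately show False
      using prob_space.emeasure_space_1 by fastforce
  qed
  moreover have "0 \<le> s"
    unfolding s_def by (intro infsum_nonneg edge_weight_nonneg)
  ultimately have s: "0 < s" by simp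
  have P: "?P y = \<mu> x y / s" for y
    by (simp add: transition_prob_def s_def)
  have P_nonneg: "0 \<le> ?P y" for y
    using s by (simp add: P edge_weight_nonneg)
  have summable: "(\<lambda>y. ?P y * ?f y) summable_on UNIV"
    using u by (simp add: harmonic_map_def harmonic_map_domain_def mult.commute)
  have "?f x \<le> (LINT p|?\<nu>. dist p z)"
    by (rule barycenter_dist_le_integral[OF H b])
  also have "\<dots> = (LINT y|transition_measure \<mu> x. ?f y)"
    by (rule integral_distr) (auto simp: transition_measure_def intro!: borel_measurable_continuous_onI continuous_intros)
  also have "\<dots> = (LINT y|count_space UNIV. ?P y * ?f y)"
    unfolding transition_measure_def by (subst integral_density) (auto simp: P_nonneg)
  also have "\<dots> = (\<Sum>\<^sub>\<infinity>y\<in>UNIV. ?P y * ?f y)"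
    unfolding infsetsum_def[symmetric]
  proof (rule infsetsum_infsum)
    show "Infinite_Set_Sum.abs_summable_on (\<lambda>y. ?P y * ?f y) UNIV"
      unfolding abs_summable_equivalent[symmetric]
      by (rule summable[THEN summable_on_iff_abs_summable_on_real[THEN iffD1]])
  qed
  finally have mean: "?f x \<le> (\<Sum>\<^sub>\<infinity>y\<in>UNIV. ?P y * ?f y)" .
  have "((\<lambda>y. \<mu> x y * ?f x + (- s) * (?P y * ?f y))
      has_sum s * ?f x + (- s) * (\<Sum>\<^sub>\<infinity>y\<in>UNIV. ?P y * ?f y)) UNIV"
    unfolding s_def
    by (intro has_sum_add has_sum_cmult_left has_sum_cmult_right has_sum_infsum
        edge_weight_summable summable)
  moreover have "(\<lambda>y. \<mu> x y * ?f x + (- s) * (?P y * ?f y)) = (\<lambda>y. \<mu> x y * (?f x - ?f y))"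
    using s by (simp add: P right_diff_distrib fun_eq_iff)
  ultimately have "net_flow ?f x = s * ?f x + (- s) * (\<Sum>\<^sub>\<infinity>y\<in>UNIV. ?P y * ?f y)"
    unfolding net_flow_def by (intro infsumI) simp
  also have "\<dots> \<le> 0"
    using mult_left_mono[OF mean] s by simp
  finally show "net_flow ?f x \<le> 0" .
qed

end

theorem theorem1p12:
  fixes m :: "'v::countable \<Rightarrow> real" and \<mu> :: "'v \<Rightarrow> 'v \<Rightarrow> real"
    and u :: "'v \<Rightarrow> 'y::metric_space"
  assumes "weighted_graph m \<mu>"
    and "connected_graph \<mu>"
    and "\<And>f :: 'v \<Rightarrow> real.
           harmonic_function m \<mu> f \<Longrightarrow> finite_energy \<mu> f \<Longrightarrow> bounded (range f)"
    and "hadamard_space (UNIV :: 'y set)"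
    and "harmonic_map \<mu> u"
    and "finite_energy \<mu> u"
  shows "bounded (range u)"
proof -
  interpret weighted_graph m \<mu> by (fact assms(1))
  obtain z :: 'y where True by simp
  note f = harmonic_map_dist_subharmonic[OF assms(4-6), of z]
  obtain h where h: "finite_energy \<mu> h" "\<And>x. net_flow h x = 0" "\<And>x. dist (u x) z \<le> h x"
    using harmonic_majorant[OF assms(2) f] by blast
  have "harmonic_function m \<mu> h"
    using h by (simp add: harmonic_function_iff_net_flow)
  then have "bounded (range h)"
    using h(1) by (rule assms(3))
  then obtain B where "\<And>x. \<bar>h x\<bar> \<le> B"
    by (auto simp: bounded_iff)
  then have "dist z (u x) \<le> B" for x
    using h(3)[of x] by (smt (verit) dist_commute)
  then show ?thesis
    unfolding bounded_def by blast
qed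

end
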